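(* Let $\mathcal{G}$ be a strongly connected directed graph on $n\ge 2$ nodes, and let $f_1,\dots,f_n:\mathbb{R}\to\mathbb{R}$ satisfy the standing assumption on the objective functions stated in the context, with constants $l_0,l>0$. Let $T_c>0$, let $x_1(0),\dots,x_n(0)\in\mathbb{R}$ be arbitrary, and put $C=\sum_{i=1}^n x_i(0)$. Let $\bm{x}^*$ be the unique minimizer of $f(\bm{x})=\sum_{i=1}^n f_i(x_i)$ over $\{\bm{x}\in\mathbb{R}^n:\sum_{i=1}^n x_i=C\}$. Let $\bm{x}(t)=[x_1(t),\dots,x_n(t)]^T$ be generated by the sampled-data algorithm described in the context, with sampling instants $t_0=0$, $t_k=\sum_{j=1}^k T_j$ $(k\ge 1)$, $T_k=\frac{6}{(\pi k)^2}T_c$. Suppose the constant $\beta>0$ satisfies $$\beta\le\min\left\{\frac{1}{2\|\hat{\mathcal{L}}_0\|^2\left(1+4l^2b\|\mathcal{L}_O\|^2+2l\|\mathcal{L}_O\|^2\right)},\ \frac{1}{4\left(2l^2b\|\mathcal{L}_O\|^2+l\|\mathcal{L}_O\|^2\right)},\ 1\right\},$$ where $b=\left(2\|\mathcal{M}^TW\|^2+\|W\|\right)n$. Then $\bm{x}(t)$ converges to $\bm{x}^*$ at the pre-specified time $T_c$, i.e. $\lim_{t\to T_c^-}\bm{x}(t)=\bm{x}^*$, and $\sum_{i=1}^n x_i(t)=\sum_{i=1}^n x_i(0)=C$ for all $t\in[0,T_c]$, where $\bm{x}(T_c)$ denotes this limit.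
   Context: Graph notation. $\mathcal{G}=(\mathcal{V},\mathcal{E})$ is a directed graph with $\mathcal{V}=\{1,\dots,n\}$; $(i,j)\in\mathcal{E}$ means that node $j$ can receive information from node $i$. $\mathcal{G}$ is strongly connected if from any node there are directed paths to all other nodes. The adjacency matrix $\mathcal{A}=[a_{ij}]$ has $a_{ii}=0$ and, for $i\ne j$, $a_{ij}=1$ if $(j,i)\in\mathcal{E}$ and $a_{ij}=0$ otherwise. In-degree: $d_i^{\mathrm{in}}=\sum_{j=1}^n a_{ij}$; out-degree: $d_i^{\mathrm{out}}=\sum_{j=1}^n a_{ji}$. $\mathcal{L}=\mathrm{diag}\{d_1^{\mathrm{in}},\dots,d_n^{\mathrm{in}}\}-\mathcal{A}$ is the Laplacian and $\mathcal{L}_O=\mathrm{diag}\{d_1^{\mathrm{out}},\dots,d_n^{\mathrm{out}}\}-\mathcal{A}$. Standing assumption on the objective functions. $f(\bm{x})=\sum_{i=1}^n f_i(x_i)$; each $f_i$ is twice differentiable and strongly convex with $\nabla^2 f_i(\cdot)\ge l_0$ for a given $l_0>0$; and $\nabla f$ is Lipschitz: there is $l>0$ with $\|\nabla f(\bm{a})-\nabla f(\bm{b})\|\le l\|\bm{a}-\bm{b}\|$ for all $\bm{a},\bm{b}\in\mathbb{R}^n$. Algorithm. For sampling instants $0=t_0<t_1<t_2<\cdots$, for every $k\in\mathbb{N}=\{0,1,2,\dots\}$, $t\in[t_k,t_{k+1})$ and $i,m\in\{1,\dots,n\}$: $$x_i(t)=x_i(0)-d_i^{\mathrm{out}}\xi_i(t_k)+\sum_{j=1}^n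 a_{ij}\xi_j(t_k),$$ $$\dot\xi_i(t)=\frac{\beta}{t_{k+1}-t_k}\Big(d_i^{\mathrm{out}}\psi_{ii}(t_k)-\sum_{j=1}^n a_{ji}\psi_{ij}(t_k)\Big),$$ $$\dot\psi_{im}(t)=-\frac{1}{(t_{k+1}-t_k)(d_i^{\mathrm{in}}+a_{im})}\Big(\sum_{j=1}^n a_{ij}\big(\psi_{im}(t_k)-\psi_{jm}(t_k)\big)+a_{im}\big(\psi_{im}(t_k)-f_m'(x_m(t_k))\big)\Big),$$ with $\xi_i,\psi_{im}$ continuous, $\xi_i(0)=0$, $\psi_{im}(0)=0$. Matrices. $\hat{\mathcal{L}}_0=\mathrm{diag}\{(\mathcal{L}_O^T)_1,\dots,(\mathcal{L}_O^T)_n\}\in\mathbb{R}^{n\times n^2}$ is block diagonal, $(\mathcal{L}_O^T)_i$ being the $i$th row of $\mathcal{L}_O^T$. $\Gamma\in\mathbb{R}^{n^2\times n^2}$ is diagonal with entries $\frac{1}{d_i^{\mathrm{in}}+a_{ij}}$ and $A_d\in\mathbb{R}^{n^2\times n^2}$ is diagonal with entries $a_{ij}$, both with index pairs in the order $(1,1),\dots,(1,n),(2,1),\dots,(2,n),\dots,(n,n)$. $\mathcal{M}=I_{n^2}-\Gamma(\mathcal{L}\otimes I_n+A_d)$, where $\otimes$ is the Kronecker product. When $\mathcal{G}$ is strongly connected, $\mathcal{M}$ is a Schur matrix (all eigenvalues of modulus less than $1$), and $W$ denotes the symmetric positive definite matrix with $\mathcal{M}^TW\mathcal{M}-W=-I_{n^2}$.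 $\|\cdot\|$ is the Euclidean norm for vectors and the induced spectral norm for matrices. *)

theory Defs
  imports "HOL-Analysis.Analysis"
begin

text \<open>
  The node set is an arbitrary finite type \<open>'n\<close>, so that \<open>n = CARD('n)\<close>, and a directed graph is its
  edge set, where \<open>(i, j) \<in> E\<close> means that \<open>j\<close> receives information from \<open>i\<close>.
  Vectors and matrices of size \<open>n\<^sup>2\<close> are indexed by pairs of nodes.
\<close>

definition strongly_connected :: "('n \<times> 'n) set \<Rightarrow> bool" where
  "strongly_connected E \<longleftrightarrow> (\<forall>i j. (i, j) \<in> E\<^sup>*)"

definition adj :: "('n \<times> 'n) set \<Rightarrow> real^'n::finite^'n" where
  "adj E = (\<chi> i j. if i \<noteq> j \<and> (j, i) \<in> E then 1 else 0)"

definition in_deg :: "('n::finite \<times> 'n) set \<Rightarrow> 'n \<Rightarrow> real" where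
  "in_deg E i = (\<Sum>j\<in>UNIV. adj E $ i $ j)"

definition out_deg :: "('n::finite \<times> 'n) set \<Rightarrow> 'n \<Rightarrow> real" where
  "out_deg E i = (\<Sum>j\<in>UNIV. adj E $ j $ i)"

definition diag_mat :: "('a::finite \<Rightarrow> real) \<Rightarrow> real^'a^'a" where
  "diag_mat d = (\<chi> i j. if i = j then d i else 0)"

definition laplacian :: "('n::finite \<times> 'n) set \<Rightarrow> real^'n^'n" where
  "laplacian E = diag_mat (in_deg E) - adj E"

definition laplacian_out :: "('n::finite \<times> 'n) set \<Rightarrow> real^'n^'n" where
  "laplacian_out E = diag_mat (out_deg E) - adj E"

definition kronecker ::
    "real^'b::finite^'a::finite \<Rightarrow> real^'d::finite^'c::finite \<Rightarrow> real^('b \<times> 'd)^('a \<times> 'c)" where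
  "kronecker A B = (\<chi> p q. A $ fst p $ fst q * B $ snd p $ snd q)"

text \<open>
  The \<open>n \<times> n\<^sup>2\<close> block-diagonal matrix whose \<open>i\<close>-th diagonal block is the \<open>i\<close>-th row of the transpose of
  \<^term>\<open>laplacian_out E\<close>; the columns \<open>(i, m)\<close> with fixed \<open>i\<close> make up the \<open>i\<close>-th block.
\<close>

definition lap_hat :: "('n::finite \<times> 'n) set \<Rightarrow> real^('n \<times> 'n)^'n" where
  "lap_hat E = (\<chi> i q. if i = fst q then row i (transpose (laplacian_out E)) $ snd q else 0)"

definition Gamma_mat :: "('n::finite \<times> 'n) set \<Rightarrow> real^('n \<times> 'n)^('n \<times> 'n)" where
  "Gamma_mat E = diag_mat (\<lambda>(i, j). 1 / (in_deg E i + adj E $ i $ j))"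

definition Ad_mat :: "('n::finite \<times> 'n) set \<Rightarrow> real^('n \<times> 'n)^('n \<times> 'n)" where
  "Ad_mat E = diag_mat (\<lambda>(i, j). adj E $ i $ j)"

definition M_mat :: "('n::finite \<times> 'n) set \<Rightarrow> real^('n \<times> 'n)^('n \<times> 'n)" where
  "M_mat E = mat 1 - Gamma_mat E ** (kronecker (laplacian E) (mat 1 :: real^'n^'n) + Ad_mat E)"

definition sym_pos_def :: "real^'a::finite^'a \<Rightarrow> bool" where
  "sym_pos_def W \<longleftrightarrow> transpose W = W \<and> (\<forall>v. v \<noteq> 0 \<longrightarrow> v \<bullet> (W *v v) > 0)"

definition lyapunov_solution :: "real^'a::finite^'a \<Rightarrow> real^'a^'a \<Rightarrow> bool" where
  "lyapunov_solution M W \<longleftrightarrow> sym_pos_def W \<and> transpose M ** W ** M - W = - mat 1"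

definition spectral_norm :: "real^'b::finite^'a::finite \<Rightarrow> real" where
  "spectral_norm A = onorm (\<lambda>v. A *v v)"

definition objective :: "('n::finite \<Rightarrow> real \<Rightarrow> real) \<Rightarrow> real^'n \<Rightarrow> real" where
  "objective f x = (\<Sum>i\<in>UNIV. f i (x $ i))"

text \<open>
  Strong convexity of the twice differentiable functions \<open>f i\<close> is expressed by the uniform lower
  bound \<open>l0 > 0\<close> on the second derivative.
\<close>

definition objective_assumption :: "('n::finite \<Rightarrow> real \<Rightarrow> real) \<Rightarrow> real \<Rightarrow> real \<Rightarrow> bool" where
  "objective_assumption f l0 l \<longleftrightarrow>
     l0 > 0 \<and> l > 0 \<and>
     (\<forall>i s. f i differentiable (at s)) \<and>
     (\<forall>i s. deriv (f i) differentiable (at s)) \<and>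
     (\<forall>i s. deriv (deriv (f i)) s \<ge> l0) \<and>
     (\<exists>g. (\<forall>x. GDERIV (objective f) x :> g x) \<and> l-lipschitz_on UNIV g)"

text \<open>
  The right-hand sides jump at the sampling instants, so the differential equations hold in the sense
  of one-sided derivatives at the left end of each sampling interval.
\<close>

definition generated_by_algorithm ::
    "('n::finite \<times> 'n) set \<Rightarrow> ('n \<Rightarrow> real \<Rightarrow> real) \<Rightarrow> real \<Rightarrow> (nat \<Rightarrow> real) \<Rightarrow>
     (real \<Rightarrow> real^'n) \<Rightarrow> ('n \<Rightarrow> real \<Rightarrow> real) \<Rightarrow> ('n \<Rightarrow> 'n \<Rightarrow> real \<Rightarrow> real) \<Rightarrow> bool" where
  "generated_by_algorithm E f \<beta> t x \<xi> \<psi> \<longleftrightarrow>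
     (\<forall>i. \<xi> i 0 = 0 \<and> continuous_on (\<Union>k. {t k..<t (Suc k)}) (\<xi> i)) \<and>
     (\<forall>i m. \<psi> i m 0 = 0 \<and> continuous_on (\<Union>k. {t k..<t (Suc k)}) (\<psi> i m)) \<and>
     (\<forall>k. \<forall>s\<in>{t k..<t (Suc k)}. \<forall>i.
        x s $ i = x 0 $ i - out_deg E i * \<xi> i (t k) + (\<Sum>j\<in>UNIV. adj E $ i $ j * \<xi> j (t k))) \<and>
     (\<forall>k. \<forall>s\<in>{t k..<t (Suc k)}. \<forall>i.
        (\<xi> i has_real_derivative
           \<beta> / (t (Suc k) - t k) *
             (out_deg E i * \<psi> i i (t k) - (\<Sum>j\<in>UNIV. adj E $ j $ i * \<psi> i j (t k))))
        (at s within {t k..<t (Suc k)})) \<and>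
     (\<forall>k. \<forall>s\<in>{t k..<t (Suc k)}. \<forall>i m.
        (\<psi> i m has_real_derivative
           - (1 / ((t (Suc k) - t k) * (in_deg E i + adj E $ i $ m))) *
             ((\<Sum>j\<in>UNIV. adj E $ i $ j * (\<psi> i m (t k) - \<psi> j m (t k)))
              + adj E $ i $ m * (\<psi> i m (t k) - deriv (f m) (x (t k) $ m))))
        (at s within {t k..<t (Suc k)}))"

text \<open>As \<open>\<Sum>k\<ge>1. 1 / k\<^sup>2 = \<pi>\<^sup>2 / 6\<close>, the instants increase to \<open>Tc\<close> and the sampling intervals cover
  \<open>{0..<Tc}\<close>.\<close>

definition sampling_instant :: "real \<Rightarrow> nat \<Rightarrow> real" where
  "sampling_instant Tc k = (\<Sum>j=1..k. 6 / (pi * real j)^2 * Tc)"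

definition b_const :: "('n::finite \<times> 'n) set \<Rightarrow> real^('n \<times> 'n)^('n \<times> 'n) \<Rightarrow> real" where
  "b_const E W =
     (2 * (spectral_norm (transpose (M_mat E) ** W))^2 + spectral_norm W) * real CARD('n)"

definition gain_bound ::
    "('n::finite \<times> 'n) set \<Rightarrow> real \<Rightarrow> real^('n \<times> 'n)^('n \<times> 'n) \<Rightarrow> real" where
  "gain_bound E l W =
     Min {1 / (2 * (spectral_norm (lap_hat E))^2 *
                (1 + 4 * l^2 * b_const E W * (spectral_norm (laplacian_out E))^2
                   + 2 * l * (spectral_norm (laplacian_out E))^2)),
          1 / (4 * (2 * l^2 * b_const E W * (spectral_norm (laplacian_out E))^2
                   + l * (spectral_norm (laplacian_out E))^2)),
          1}"

end

theory Submission imports Defs begin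

text \<open>
  At the sampling instants the algorithm is a gradient descent for \<open>\<xi> \<mapsto> f (x 0 - L\<^sub>O \<xi>)\<close> in which the
  gradient is replaced by its estimate \<open>\<psi>\<close>, and the error \<open>e\<close> of that estimate is multiplied by the
  Schur matrix \<open>M\<close> and perturbed by the increment of \<open>\<nabla>f\<close>. Under the gain bound the energy
  \<open>f x + e \<bullet> W e\<close> decreases by a positive multiple of \<open>\<parallel>\<Delta>\<xi>\<parallel>\<^sup>2 + \<parallel>e\<parallel>\<^sup>2\<close> in each step; as it is bounded
  below, \<open>L\<^sub>O\<^sup>T \<nabla>f x\<close> tends to zero. By strong connectivity the kernel of \<open>L\<^sub>O\<^sup>T\<close> consists of the constant
  vectors, so \<open>\<nabla>f x\<close> becomes constant up to a vanishing error, and strong convexity forces \<open>x\<close> to the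
  minimizer. The instants accumulate at \<open>Tc\<close> because \<open>\<Sum>k\<ge>1. 1 / k\<^sup>2 = \<pi>\<^sup>2 / 6\<close>.
\<close>

section \<open>Functions with Lipschitz gradient\<close>

lemma GDERIV_line_has_real_derivative:
  fixes F :: "'a::real_inner \<Rightarrow> real"
  assumes "\<And>x. GDERIV F x :> g x"
  shows "((\<lambda>t. F (x + t *\<^sub>R d)) has_real_derivative g (x + t *\<^sub>R d) \<bullet> d) (at t)"
proof -
  have l: "((\<lambda>t. x + t *\<^sub>R d) has_derivative (\<lambda>t. t *\<^sub>R d)) (at t)"
    by (auto intro!: derivative_eq_intros)
  have "(F has_derivative (\<lambda>h. h \<bullet> g (x + t *\<^sub>R d))) (at (x + t *\<^sub>R d))"
    using assms by (simp add: gderiv_def)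
  from diff_chain_at[OF l this] show ?thesis
    by (simp add: has_field_derivative_def o_def inner_commute mult_commute_abs)
qed

text \<open>Descent lemma: along the segment from \<open>x\<close> to \<open>y\<close>,
  \<open>p\<close> is \<open>F\<close> minus its quadratic upper model up to the constant
  \<open>F x\<close>. Cauchy-Schwarz and the Lipschitz bound make the derivative of \<open>p\<close>
  nonpositive, so \<open>p 1 \<le> p 0\<close>.\<close>

lemma lipschitz_gradient_upper_bound:
  fixes F :: "'a::real_inner \<Rightarrow> real"
  assumes F: "\<And>x. GDERIV F x :> g x" and g: "l-lipschitz_on UNIV g"
  shows "F y \<le> F x + g x \<bullet> (y - x) + l / 2 * (norm (y - x))\<^sup>2"
proof -
  define d where "d = y - x"
  define p where "p t = F (x + t *\<^sub>R d) - t * (g x \<bullet> d) - l * t\<^sup>2 / 2 * (norm d)\<^sup>2" for t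
  have p': "(p has_real_derivative (g (x + t *\<^sub>R d) \<bullet> d - g x \<bullet> d - l * t * (norm d)\<^sup>2)) (at t)" for t
    unfolding p_def by (auto intro!: derivative_eq_intros GDERIV_line_has_real_derivative F)
  have "g (x + t *\<^sub>R d) \<bullet> d - g x \<bullet> d - l * t * (norm d)\<^sup>2 \<le> 0" if "t \<ge> 0" for t
  proof -
    have "g (x + t *\<^sub>R d) \<bullet> d - g x \<bullet> d \<le> norm (g (x + t *\<^sub>R d) - g x) * norm d"
      by (simp add: inner_diff_left[symmetric] norm_cauchy_schwarz)
    also have "norm (g (x + t *\<^sub>R d) - g x) \<le> l * norm (t *\<^sub>R d)"
      using lipschitz_onD[OF g, of "x + t *\<^sub>R d" x] by (simp add: dist_norm)
    finally show ?thesis using that by (simp add: power2_eq_square mult_right_mono mult.assoc)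
  qed
  with p' have "\<exists>D. (p has_real_derivative D) (at t) \<and> D \<le> 0" if "t \<ge> 0" for t
    using that by blast
  then have "p 1 \<le> p 0"
    by (intro DERIV_nonpos_imp_nonincreasing[of 0 1 p]) simp_all
  then show ?thesis by (simp add: p_def d_def)
qed

section \<open>Energy estimates\<close>

lemma norm_matrix_vector_le_spectral_norm:
  fixes A :: "real^'b::finite^'a::finite"
  shows "norm (A *v v) \<le> spectral_norm A * norm v"
  unfolding spectral_norm_def by (rule onorm) simp

lemma spectral_norm_nonneg: "spectral_norm A \<ge> 0"
  unfolding spectral_norm_def by (rule onorm_pos_le) simp

text \<open>The Lyapunov equation yields the decrease by the square of \<open>norm e\<close>.
  Young's inequality for the cross term gives back half of it and produces the square of the norm of
  \<open>transpose M ** W\<close>, which explains the first summand of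
  \<open>b_const\<close>.\<close>

lemma lyapunov_solution_step:
  fixes M W :: "real^'a::finite^'a"
  assumes "lyapunov_solution M W"
  shows "(M *v e + h) \<bullet> (W *v (M *v e + h)) \<le> e \<bullet> (W *v e) - (norm e)\<^sup>2 / 2
           + (2 * (spectral_norm (transpose M ** W))\<^sup>2 + spectral_norm W) * (norm h)\<^sup>2"
proof -
  have W: "transpose W = W" and ly: "transpose M ** W ** M = W - mat 1"
    using assms by (auto simp: lyapunov_solution_def sym_pos_def_def algebra_simps)
  define a where "a = spectral_norm (transpose M ** W) * norm h"
  have M: "(M *v u) \<bullet> v = u \<bullet> (transpose M *v v)" for u v
    by (metis dot_lmul_matrix inner_commute transpose_matrix_vector)
  have 1: "(M *v e) \<bullet> (W *v (M *v e)) = e \<bullet> (W *v e) - (norm e)\<^sup>2"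
  proof -
    have "(M *v e) \<bullet> (W *v (M *v e)) = e \<bullet> ((transpose M ** W ** M) *v e)"
      by (simp only: M matrix_vector_mul_assoc matrix_mul_assoc)
    then show ?thesis
      by (simp add: ly matrix_vector_mult_diff_rdistrib inner_diff_right power2_norm_eq_inner)
  qed
  have 2: "(M *v e) \<bullet> (W *v h) = e \<bullet> ((transpose M ** W) *v h)"
    by (simp only: M matrix_vector_mul_assoc)
  have "h \<bullet> (W *v (M *v e)) = (W *v h) \<bullet> (M *v e)"
    by (metis W dot_lmul_matrix transpose_matrix_vector)
  then have 3: "h \<bullet> (W *v (M *v e)) = (M *v e) \<bullet> (W *v h)"
    by (simp add: inner_commute)
  have "e \<bullet> ((transpose M ** W) *v h) \<le> norm e * a"
    unfolding a_def
    by (rule order_trans[OF norm_cauchy_schwarz mult_left_mono[OF norm_matrix_vector_le_spectral_norm]])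
       simp
  moreover have "2 * (norm e * a) \<le> (norm e)\<^sup>2 / 2 + 2 * a\<^sup>2"
    using zero_le_power2[of "norm e - 2 * a"] by (simp add: power2_eq_square algebra_simps)
  ultimately have 4: "2 * (e \<bullet> ((transpose M ** W) *v h)) \<le> (norm e)\<^sup>2 / 2 + 2 * a\<^sup>2" by linarith
  have "h \<bullet> (W *v h) \<le> norm h * (spectral_norm W * norm h)"
    by (rule order_trans[OF norm_cauchy_schwarz mult_left_mono[OF norm_matrix_vector_le_spectral_norm]])
       simp
  then have 5: "h \<bullet> (W *v h) \<le> spectral_norm W * (norm h)\<^sup>2"
    by (simp add: power2_eq_square mult_ac)
  have "(M *v e + h) \<bullet> (W *v (M *v e + h)) = (M *v e) \<bullet> (W *v (M *v e))
      + (M *v e) \<bullet> (W *v h) + h \<bullet> (W *v (M *v e)) + h \<bullet> (W *v h)"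
    by (simp only: matrix_vector_right_distrib inner_add_left inner_add_right add.assoc)
  moreover have "(2 * (spectral_norm (transpose M ** W))\<^sup>2 + spectral_norm W) * (norm h)\<^sup>2
      = 2 * a\<^sup>2 + spectral_norm W * (norm h)\<^sup>2"
    unfolding a_def power_mult_distrib by (simp only: distrib_right mult.assoc)
  ultimately show ?thesis
    using 1 2 3 4 5 by linarith
qed

text \<open>Substituting \<open>L\<^sup>T \<nabla>F = d / \<beta> - H e\<close> turns the first-order term of the descent
  estimate into \<open>- \<parallel>d\<parallel>\<^sup>2 / \<beta> + H e \<bullet> d\<close>; the two gain bounds leave three eighths of
  \<open>\<parallel>d\<parallel>\<^sup>2 / \<beta>\<close> after the remaining terms have been absorbed.\<close>

lemma inexact_gradient_step_energy_decrease:
  fixes F :: "real^'n::finite \<Rightarrow> real" and L :: "real^'n^'n" and H :: "real^'p::finite^'n"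
    and M W :: "real^'p^'p" and e h :: "real^'p"
  assumes F: "\<And>x. GDERIV F x :> g x" and g: "l-lipschitz_on UNIV g"
    and W: "lyapunov_solution M W"
    and \<beta>: "0 < \<beta>"
    and \<beta>1: "2 * \<beta> * (spectral_norm H)\<^sup>2 \<le> 1"
    and \<beta>2: "4 * \<beta> * (2 * l\<^sup>2 * b * (spectral_norm L)\<^sup>2 + l * (spectral_norm L)\<^sup>2) \<le> 1"
    and b: "b = (2 * (spectral_norm (transpose M ** W))\<^sup>2 + spectral_norm W) * N" "N \<ge> 0"
    and d: "d = \<beta> *\<^sub>R (transpose L *v g x + H *v e)"
    and h: "(norm h)\<^sup>2 = N * (norm (g (x - L *v d) - g x))\<^sup>2"
  shows "F (x - L *v d) + (M *v e + h) \<bullet> (W *v (M *v e + h))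
           \<le> F x + e \<bullet> (W *v e) - (3 / (8 * \<beta>) * (norm d)\<^sup>2 + (norm e)\<^sup>2 / 4)"
proof -
  define s where "s = spectral_norm L"
  define D where "D = (norm d)\<^sup>2"
  have l: "l \<ge> 0" using g by (rule lipschitz_on_nonneg)
  have Ld: "(norm (L *v d))\<^sup>2 \<le> s\<^sup>2 * D"
    unfolding s_def D_def power_mult_distrib[symmetric]
    by (intro power_mono norm_matrix_vector_le_spectral_norm) simp
  have "norm (g (x - L *v d) - g x) \<le> l * norm (L *v d)"
    using lipschitz_onD[OF g, of "x - L *v d" x] by (simp add: dist_norm)
  then have "(norm (g (x - L *v d) - g x))\<^sup>2 \<le> l\<^sup>2 * (norm (L *v d))\<^sup>2"
    unfolding power_mult_distrib[symmetric] by (rule power_mono) simp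
  also have "\<dots> \<le> l\<^sup>2 * (s\<^sup>2 * D)" using Ld by (rule mult_left_mono) simp
  finally have gd: "(norm (g (x - L *v d) - g x))\<^sup>2 \<le> l\<^sup>2 * (s\<^sup>2 * D)" .
  have "(2 * (spectral_norm (transpose M ** W))\<^sup>2 + spectral_norm W) * (norm h)\<^sup>2
      = b * (norm (g (x - L *v d) - g x))\<^sup>2"
    by (simp add: h b)
  also have "\<dots> \<le> b * (l\<^sup>2 * (s\<^sup>2 * D))"
    using gd b spectral_norm_nonneg[of W] by (intro mult_left_mono) auto
  finally have energy_W: "(M *v e + h) \<bullet> (W *v (M *v e + h))
      \<le> e \<bullet> (W *v e) - (norm e)\<^sup>2 / 2 + b * (l\<^sup>2 * (s\<^sup>2 * D))"
    using lyapunov_solution_step[OF W, of e h] by linarith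
  have "g x \<bullet> (L *v d) = (transpose L *v g x) \<bullet> d"
    by (metis dot_lmul_matrix transpose_matrix_vector)
  also have "transpose L *v g x = (1 / \<beta>) *\<^sub>R d - H *v e" using \<beta> by (simp add: d)
  finally have gL: "g x \<bullet> (L *v d) = D / \<beta> - (H *v e) \<bullet> d"
    by (simp add: inner_diff_left D_def power2_norm_eq_inner)
  have "F (x - L *v d) \<le> F x - g x \<bullet> (L *v d) + l / 2 * (norm (L *v d))\<^sup>2"
    using lipschitz_gradient_upper_bound[OF F g, of "x - L *v d" x] by simp
  moreover have "l / 2 * (norm (L *v d))\<^sup>2 \<le> l / 2 * (s\<^sup>2 * D)"
    using Ld l by (intro mult_left_mono) auto
  ultimately have energy_F: "F (x - L *v d) \<le> F x - D / \<beta> + (H *v e) \<bullet> d + l / 2 * (s\<^sup>2 * D)"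
    using gL by linarith
  have "(H *v e) \<bullet> d \<le> (spectral_norm H * norm e) * norm d"
    by (rule order_trans[OF norm_cauchy_schwarz mult_right_mono[OF norm_matrix_vector_le_spectral_norm]])
       simp
  \<comment> \<open>Young's inequality is weighted so that a quarter of the squared norm of
    \<open>e\<close> survives out of the half supplied by \<open>energy_W\<close>.\<close>
  moreover have "norm e * (spectral_norm H * norm d) \<le> (norm e)\<^sup>2 / 4 + (spectral_norm H * norm d)\<^sup>2"
    using zero_le_power2[of "norm e / 2 - spectral_norm H * norm d"]
    by (simp add: power2_eq_square algebra_simps)
  moreover have "(spectral_norm H * norm d)\<^sup>2 \<le> 1 / (2 * \<beta>) * D"
    unfolding power_mult_distrib D_def
    using \<beta>1 \<beta> by (intro mult_right_mono) (auto simp: field_simps)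
  ultimately have cross: "(H *v e) \<bullet> d \<le> (norm e)\<^sup>2 / 4 + 1 / (2 * \<beta>) * D"
    by (simp add: mult_ac)
  have "(l\<^sup>2 * b * s\<^sup>2 + l / 2 * s\<^sup>2) * D \<le> 1 / (8 * \<beta>) * D"
    using \<beta>2 \<beta> by (intro mult_right_mono) (auto simp: field_simps s_def D_def)
  then have quad: "b * (l\<^sup>2 * (s\<^sup>2 * D)) + l / 2 * (s\<^sup>2 * D) \<le> 1 / (8 * \<beta>) * D"
    by (simp add: algebra_simps)
  \<comment> \<open>In terms of \<open>q\<close> the estimates are linear: \<open>- q\<close> from
    the gradient step, \<open>q / 2\<close> from \<open>cross\<close> and \<open>q / 8\<close> from
    \<open>quad\<close> leave \<open>- 3 / 8 * q\<close>.\<close>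
  define q where "q = D / \<beta>"
  have q: "1 / (2 * \<beta>) * D = q / 2" "1 / (8 * \<beta>) * D = q / 8" "3 / (8 * \<beta>) * D = 3 / 8 * q"
    by (simp_all add: q_def)
  show ?thesis
    using energy_W energy_F cross quad unfolding D_def[symmetric] q q_def[symmetric] by linarith
qed

text \<open>Telescoping bounds the partial sums of \<open>r\<close> by \<open>V 0 - B\<close>, so
  \<open>r\<close> is summable.\<close>

lemma decrement_tendsto_zero:
  fixes V r :: "nat \<Rightarrow> real"
  assumes "\<And>k. V (Suc k) \<le> V k - r k" "\<And>k. r k \<ge> 0" "\<And>k. V k \<ge> B"
  shows "r \<longlonglongrightarrow> 0"
proof -
  have "(\<Sum>k<n. r k) \<le> V 0 - V n" for n
  proof (induction n)
    case (Suc n)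
    then show ?case using assms(1)[of n] by simp
  qed simp
  then have "(\<Sum>k\<le>n. r k) \<le> V 0 - B" for n
    using assms(3)[of "Suc n"] unfolding lessThan_Suc_atMost[symmetric]
    by (meson diff_left_mono order_trans)
  then have "summable r" using assms(2) by (intro bounded_imp_summable)
  then show ?thesis by (rule summable_LIMSEQ_zero)
qed

lemma tendsto_zero_norm_square_le:
  fixes u :: "nat \<Rightarrow> 'a::real_normed_vector"
  assumes r: "r \<longlonglongrightarrow> 0" and u: "\<And>k. (norm (u k))\<^sup>2 \<le> c * r k"
  shows "u \<longlonglongrightarrow> 0"
proof (rule Lim_null_comparison)
  show "\<forall>\<^sub>F k in sequentially. norm (u k) \<le> sqrt (c * r k)"
    using u by (intro always_eventually allI real_le_rsqrt)
  show "(\<lambda>k. sqrt (c * r k)) \<longlonglongrightarrow> 0"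
    using tendsto_real_sqrt[OF tendsto_mult_right_zero[OF r, of c]] by simp
qed

section \<open>The out-degree Laplacian\<close>

lemma laplacian_out_mult_nth:
  "(laplacian_out E *v y) $ i = out_deg E i * y $ i - (\<Sum>j\<in>UNIV. adj E $ i $ j * y $ j)"
proof -
  have "(laplacian_out E *v y) $ i
      = (\<Sum>j\<in>UNIV. (if i = j then out_deg E j * y $ j else 0) - adj E $ i $ j * y $ j)"
    unfolding matrix_vector_mult_def laplacian_out_def diag_mat_def
    by (auto intro!: sum.cong simp: left_diff_distrib)
  then show ?thesis by (simp add: sum_subtractf)
qed

lemma transpose_laplacian_out_mult_nth:
  "(transpose (laplacian_out E) *v y) $ i
     = out_deg E i * y $ i - (\<Sum>j\<in>UNIV. adj E $ j $ i * y $ j)"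
proof -
  have "(transpose (laplacian_out E) *v y) $ i
      = (\<Sum>j\<in>UNIV. (if j = i then out_deg E j * y $ j else 0) - adj E $ j $ i * y $ j)"
    unfolding matrix_vector_mult_def transpose_def laplacian_out_def diag_mat_def
    by (auto intro!: sum.cong simp: left_diff_distrib)
  then show ?thesis by (simp add: sum_subtractf)
qed

text \<open>Out-degrees are the column sums of the adjacency matrix, so every column of
  \<open>laplacian_out E\<close> sums to zero.\<close>

lemma transpose_laplacian_out_mult_const: "transpose (laplacian_out E) *v (\<chi> i. c) = 0"
  unfolding vec_eq_iff transpose_laplacian_out_mult_nth
  by (simp add: out_deg_def sum_distrib_right)

text \<open>The dual form of the preceding fact; it is the reason why the algorithm preserves the
  total of \<open>x\<close>.\<close>

lemma sum_laplacian_out_mult: "(\<Sum>i\<in>UNIV. (laplacian_out E *v y) $ i) = 0"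
proof -
  have "(\<Sum>i\<in>UNIV. (laplacian_out E *v y) $ i) = (\<chi> i. 1) \<bullet> (laplacian_out E *v y)"
    by (simp add: inner_vec_def)
  also have "\<dots> = (transpose (laplacian_out E) *v (\<chi> i. 1)) \<bullet> y"
    by (metis dot_lmul_matrix transpose_matrix_vector)
  finally show ?thesis by (simp only: transpose_laplacian_out_mult_const inner_zero_left)
qed

text \<open>Maximum principle: the set on which \<open>v\<close> attains its maximum is closed under outgoing
  edges.\<close>

lemma transpose_laplacian_out_kernel:
  fixes v :: "real^'n::finite"
  assumes E: "strongly_connected E" and v: "transpose (laplacian_out E) *v v = 0"
  obtains c where "v = (\<chi> i. c)"
proof -
  have "finite (range (($) v))" "range (($) v) \<noteq> {}" by auto
  from Max_in[OF this] obtain i0 where "v $ i0 = Max (range (($) v))" by (metis imageE)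
  then have max: "v $ j \<le> v $ i0" for j by simp
  have step: "v $ j = v $ i0" if ij: "(i, j) \<in> E" and i: "v $ i = v $ i0" for i j
  proof (cases "i = j")
    case False
    have "(transpose (laplacian_out E) *v v) $ i = 0" by (simp only: v zero_index)
    \<comment> \<open>At a node where \<open>v\<close> is maximal, the kernel equation is a
      vanishing sum of nonnegative terms, so each term vanishes.\<close>
    then have "(\<Sum>k\<in>UNIV. adj E $ k $ i * (v $ i0 - v $ k)) = 0"
      unfolding transpose_laplacian_out_mult_nth
      by (simp add: out_deg_def i right_diff_distrib sum_subtractf sum_distrib_right)
    moreover have "\<forall>k\<in>UNIV. adj E $ k $ i * (v $ i0 - v $ k) \<ge> 0"
      using max by (auto simp: adj_def)
    ultimately have "adj E $ j $ i * (v $ i0 - v $ j) = 0"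
      by (subst (asm) sum_nonneg_eq_0_iff) auto
    then show ?thesis using ij False by (simp add: adj_def)
  qed (use i in simp)
  have "v $ j = v $ i0" for j
  proof -
    have "(i0, j) \<in> E\<^sup>*" using E by (simp add: strongly_connected_def)
    then show ?thesis by induction (use step in auto)
  qed
  then show ?thesis using that[of "v $ i0"] by (simp add: vec_eq_iff)
qed

lemma inner_const_vec: "(\<chi> i. c) \<bullet> (y :: real^'n::finite) = c * (\<Sum>i\<in>UNIV. y $ i)"
  by (simp add: inner_vec_def sum_distrib_left)

text \<open>Pairing with a zero-sum \<open>y\<close> ignores the constant part of \<open>v\<close>,
  and on the remaining part the transposed Laplacian is injective, hence bounded below in finite
  dimension.\<close>

lemma inner_sum_zero_le_transpose_laplacian_out:
  fixes E :: "('n::finite \<times> 'n) set"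
  assumes E: "strongly_connected E"
  obtains K where "K > 0"
    "\<And>v y :: real^'n. (\<Sum>i\<in>UNIV. y $ i) = 0 \<Longrightarrow>
        v \<bullet> y \<le> K * norm (transpose (laplacian_out E) *v v) * norm y"
proof -
  \<comment> \<open>The appended coordinate sum removes the constant vectors from the
    kernel.\<close>
  define T where "T v = (transpose (laplacian_out E) *v v, \<Sum>i\<in>UNIV. v $ i)" for v :: "real^'n"
  have lin: "linear T"
    by (simp add: linear_iff T_def matrix_vector_right_distrib matrix_vector_mult_scaleR
        sum.distrib sum_distrib_left del: transpose_matrix_vector)
  have "v = 0" if "T v = 0" for v
  proof -
    have "transpose (laplacian_out E) *v v = 0" and s: "(\<Sum>i\<in>UNIV. v $ i) = 0"
      using that by (simp_all add: T_def zero_prod_def del: transpose_matrix_vector)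
    then obtain c where "v = (\<chi> i. c)" using transpose_laplacian_out_kernel[OF E] by blast
    with s show ?thesis by (simp add: vec_eq_iff)
  qed
  then have "inj T" using lin by (simp add: linear_injective_0)
  from linear_inj_bounded_below_pos[OF lin this]
  obtain B where B: "B > 0" "\<And>v. B * norm v \<le> norm (T v)" by blast
  have "v \<bullet> y \<le> 1 / B * norm (transpose (laplacian_out E) *v v) * norm y"
    if y: "(\<Sum>i\<in>UNIV. y $ i) = 0" for v y :: "real^'n"
  proof -
    \<comment> \<open>Subtracting the mean makes the second component of \<open>T w\<close> zero and
      changes neither the first component nor the product with \<open>y\<close>.\<close>
    define m where "m = (\<Sum>i\<in>UNIV. v $ i) / CARD('n)"
    define w where "w = v - (\<chi> i. m)"
    have "T w = (transpose (laplacian_out E) *v v, 0)"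
      unfolding T_def w_def matrix_vector_mult_diff_distrib transpose_laplacian_out_mult_const
      by (simp add: m_def sum_subtractf)
    then have "B * norm w \<le> norm (transpose (laplacian_out E) *v v)"
      using B(2)[of w] by (simp add: norm_Pair)
    then have w: "norm w \<le> 1 / B * norm (transpose (laplacian_out E) *v v)"
      using B(1) by (simp add: field_simps)
    have "v \<bullet> y = w \<bullet> y" by (simp add: w_def inner_diff_left inner_const_vec y)
    also have "\<dots> \<le> norm w * norm y" by (rule norm_cauchy_schwarz)
    also have "\<dots> \<le> 1 / B * norm (transpose (laplacian_out E) *v v) * norm y"
      using w by (rule mult_right_mono) simp
    finally show ?thesis .
  qed
  then show ?thesis using B(1) that[of "1 / B"] by simp
qed

section \<open>The tracking matrix\<close>

lemma diag_mat_mult_nth: "(diag_mat d *v v) $ i = d i * v $ i"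
proof -
  have "(diag_mat d *v v) $ i = (\<Sum>j\<in>UNIV. if i = j then d j * v $ j else 0)"
    unfolding matrix_vector_mult_def diag_mat_def vec_lambda_beta by (intro sum.cong) auto
  then show ?thesis by simp
qed

lemma kronecker_mat_1_mult_nth:
  fixes A :: "real^'b::finite^'a::finite" and v :: "real^('b \<times> 'c::finite)"
  shows "(kronecker A (mat 1 :: real^'c^'c) *v v) $ (i, m) = (\<Sum>j\<in>UNIV. A $ i $ j * v $ (j, m))"
proof -
  have "(kronecker A (mat 1 :: real^'c^'c) *v v) $ (i, m)
      = (\<Sum>(j, k)\<in>UNIV \<times> UNIV. A $ i $ j * mat 1 $ m $ k * v $ (j, k))"
    by (simp add: matrix_vector_mult_def kronecker_def split_beta)
  also have "\<dots> = (\<Sum>j\<in>UNIV. \<Sum>k\<in>UNIV. if m = k then A $ i $ j * v $ (j, k) else 0)"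
    unfolding sum.cartesian_product[symmetric] mat_def by (intro sum.cong) auto
  finally show ?thesis by simp
qed

text \<open>Written as a sum of differences, to match the update of \<open>\<psi>\<close> with the
  reference values \<open>f_m'\<close> replaced by zero.\<close>

lemma M_mat_mult_nth:
  "(M_mat E *v v) $ (i, m) = v $ (i, m) - 1 / (in_deg E i + adj E $ i $ m) *
     ((\<Sum>j\<in>UNIV. adj E $ i $ j * (v $ (i, m) - v $ (j, m))) + adj E $ i $ m * v $ (i, m))"
proof -
  have "(\<Sum>j\<in>UNIV. laplacian E $ i $ j * v $ (j, m))
      = (\<Sum>j\<in>UNIV. (if i = j then in_deg E i * v $ (j, m) else 0) - adj E $ i $ j * v $ (j, m))"
    unfolding laplacian_def diag_mat_def by (auto intro!: sum.cong simp: left_diff_distrib)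
  also have "\<dots> = in_deg E i * v $ (i, m) - (\<Sum>j\<in>UNIV. adj E $ i $ j * v $ (j, m))"
    by (simp add: sum_subtractf)
  also have "\<dots> = (\<Sum>j\<in>UNIV. adj E $ i $ j * (v $ (i, m) - v $ (j, m)))"
    by (simp add: in_deg_def sum_distrib_right right_diff_distrib sum_subtractf)
  finally show ?thesis
    unfolding M_mat_def Gamma_mat_def Ad_mat_def
    by (simp add: matrix_vector_mult_diff_rdistrib matrix_vector_mult_add_rdistrib
        matrix_vector_mul_assoc[symmetric] diag_mat_mult_nth kronecker_mat_1_mult_nth)
qed

lemma lap_hat_mult_nth:
  "(lap_hat E *v v) $ i = out_deg E i * v $ (i, i) - (\<Sum>j\<in>UNIV. adj E $ j $ i * v $ (i, j))"
proof -
  have "(lap_hat E *v v) $ i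
      = (\<Sum>(j, k)\<in>UNIV \<times> UNIV. if i = j then laplacian_out E $ k $ i * v $ (j, k) else 0)"
    unfolding matrix_vector_mult_def lap_hat_def
    by (auto intro!: sum.cong simp: row_def transpose_def)
  also have "\<dots> = (\<Sum>j\<in>UNIV. if i = j then \<Sum>k\<in>UNIV. laplacian_out E $ k $ i * v $ (j, k) else 0)"
    unfolding sum.cartesian_product[symmetric] by (intro sum.cong) auto
  also have "\<dots> = (\<Sum>k\<in>UNIV. laplacian_out E $ k $ i * v $ (i, k))" by simp
  also have "\<dots> = (\<Sum>k\<in>UNIV. (if k = i then out_deg E k * v $ (i, k) else 0)
                      - adj E $ k $ i * v $ (i, k))"
    unfolding laplacian_out_def diag_mat_def by (auto intro!: sum.cong simp: left_diff_distrib)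
  finally show ?thesis by (simp add: sum_subtractf)
qed

text \<open>The Kronecker product of the all-ones vector with \<open>v\<close>: the state
  \<open>\<psi>\<close> in which every node knows all components of \<open>v\<close>.\<close>

definition copies :: "real^'n::finite \<Rightarrow> real^('n \<times> 'n)" where
  "copies v = (\<chi> p. v $ snd p)"

lemma copies_nth [simp]: "copies v $ (i, m) = v $ m"
  by (simp add: copies_def)

text \<open>Source of the factor \<open>CARD('n)\<close> in \<open>b_const\<close>.\<close>

lemma norm_copies: "(norm (copies (v :: real^'n::finite)))\<^sup>2 = CARD('n) * (norm v)\<^sup>2"
proof -
  have "(norm (copies v))\<^sup>2 = (\<Sum>(i, m)\<in>(UNIV :: 'n set) \<times> UNIV. v $ m * v $ m)"
    by (simp add: power2_norm_eq_inner inner_vec_def copies_def split_beta)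
  also have "\<dots> = CARD('n) * (norm v)\<^sup>2"
    unfolding sum.cartesian_product[symmetric] by (simp add: power2_norm_eq_inner inner_vec_def)
  finally show ?thesis .
qed

text \<open>Block \<open>i\<close> of \<open>lap_hat E\<close> is row \<open>i\<close> of the
  transposed Laplacian and meets the \<open>i\<close>-th copy of \<open>v\<close>: exact estimates
  produce the exact descent direction.\<close>

lemma lap_hat_copies: "lap_hat E *v copies v = transpose (laplacian_out E) *v v"
  by (simp add: vec_eq_iff lap_hat_mult_nth transpose_laplacian_out_mult_nth
      del: transpose_matrix_vector)

section \<open>The objective\<close>

text \<open>The assumption provides a Lipschitz gradient only by existence. Comparing directional
  derivatives identifies it with the vector of the \<open>deriv (f i)\<close>, which the algorithm
  evaluates.\<close>

lemma objective_gradient: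
  assumes f: "\<And>i s. f i differentiable (at s)"
    and g: "\<And>x. GDERIV (objective f) x :> g x"
  shows "g x = (\<chi> i. deriv (f i) (x $ i))"
proof -
  have f': "(f i has_real_derivative deriv (f i) s) (at s)" for i s
    using f DERIV_deriv_iff_real_differentiable by blast
  have "g x \<bullet> d = (\<chi> i. deriv (f i) (x $ i)) \<bullet> d" for d
  proof -
    have "((\<lambda>t. f i (x $ i + t * d $ i)) has_real_derivative deriv (f i) (x $ i) * d $ i) (at 0)" for i
    proof -
      have "((\<lambda>t. x $ i + t * d $ i) has_real_derivative d $ i) (at 0)"
        by (auto intro!: derivative_eq_intros)
      from DERIV_chain2[OF _ this, of "f i" "deriv (f i) (x $ i)"] f' show ?thesis by simp
    qed
    then have "((\<lambda>t. \<Sum>i\<in>UNIV. f i (x $ i + t * d $ i)) has_real_derivative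
        (\<Sum>i\<in>UNIV. deriv (f i) (x $ i) * d $ i)) (at 0)"
      by (intro DERIV_sum)
    then have "((\<lambda>t. objective f (x + t *\<^sub>R d)) has_real_derivative
        (\<Sum>i\<in>UNIV. deriv (f i) (x $ i) * d $ i)) (at 0)"
      by (simp add: objective_def)
    from DERIV_unique[OF GDERIV_line_has_real_derivative[OF g] this]
    show ?thesis by (simp add: inner_vec_def)
  qed
  then show ?thesis using vector_eq_rdot by blast
qed

text \<open>Subtracting \<open>c * s\<close> from \<open>\<phi>\<close> leaves a nondecreasing
  function. The intended \<open>\<phi>\<close> is the first derivative of some
  \<open>f i\<close>.\<close>

lemma deriv_strongly_monotone:
  fixes \<phi> \<phi>' :: "real \<Rightarrow> real"
  assumes "\<And>s. (\<phi> has_real_derivative \<phi>' s) (at s)" and "\<And>s. \<phi>' s \<ge> c"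
  shows "c * (a - b)\<^sup>2 \<le> (\<phi> a - \<phi> b) * (a - b)"
proof -
  define q where "q s = \<phi> s - c * s" for s
  have q': "(q has_real_derivative \<phi>' s - c) (at s)" for s
    unfolding q_def by (auto intro!: derivative_eq_intros assms(1))
  have "\<exists>D. (q has_real_derivative D) (at s) \<and> D \<ge> 0" for s
    using q'[of s] assms(2)[of s] by (intro exI[of _ "\<phi>' s - c"]) simp
  then have "q u \<le> q v" if "u \<le> v" for u v
    using that by (intro DERIV_nonneg_imp_nondecreasing[of u v q]) simp_all
  then have "(q a - q b) * (a - b) \<ge> 0"
    by (cases "a \<le> b") (auto intro: mult_nonneg_nonneg mult_nonpos_nonpos)
  then show ?thesis by (simp add: q_def algebra_simps power2_eq_square)
qed

lemma gradient_strongly_monotone: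
  fixes x y :: "real^'n::finite"
  assumes "objective_assumption f l0 l"
  defines "G \<equiv> \<lambda>z :: real^'n. (\<chi> i. deriv (f i) (z $ i))"
  shows "l0 * (norm (x - y))\<^sup>2 \<le> (G x - G y) \<bullet> (x - y)"
proof -
  have "l0 * (x $ i - y $ i)\<^sup>2
      \<le> (deriv (f i) (x $ i) - deriv (f i) (y $ i)) * (x $ i - y $ i)" for i
  proof (rule deriv_strongly_monotone)
    show "(deriv (f i) has_real_derivative deriv (deriv (f i)) s) (at s)" for s
      using assms DERIV_deriv_iff_real_differentiable by (auto simp: objective_assumption_def)
    show "deriv (deriv (f i)) s \<ge> l0" for s
      using assms by (simp add: objective_assumption_def)
  qed
  then have "(\<Sum>i\<in>UNIV. l0 * (x $ i - y $ i)\<^sup>2)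
      \<le> (\<Sum>i\<in>UNIV. (deriv (f i) (x $ i) - deriv (f i) (y $ i)) * (x $ i - y $ i))"
    by (rule sum_mono)
  then show ?thesis
    by (simp add: power2_norm_eq_inner inner_vec_def G_def sum_distrib_left)
      (simp add: power2_eq_square)
qed

text \<open>Zero-sum directions keep the constraint, so \<open>t = 0\<close> minimizes
  \<open>F (z + t *\<^sub>R y)\<close> over the whole line.\<close>

lemma constrained_minimizer_gradient:
  fixes F :: "real^'n::finite \<Rightarrow> real"
  assumes F: "\<And>x. GDERIV F x :> g x"
    and min: "is_arg_min F (\<lambda>y. (\<Sum>i\<in>UNIV. y $ i) = C) z"
    and y: "(\<Sum>i\<in>UNIV. y $ i) = 0"
  shows "g z \<bullet> y = 0"
proof -
  have "F (z + 0 *\<^sub>R y) \<le> F (z + t *\<^sub>R y)" for t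
    using min y by (simp add: is_arg_min_linorder sum.distrib sum_distrib_left[symmetric])
  then have "g (z + 0 *\<^sub>R y) \<bullet> y = 0"
    by (intro DERIV_local_min[OF GDERIV_line_has_real_derivative[OF F], of 1]) auto
  then show ?thesis by simp
qed

section \<open>Sampling\<close>

lemma sampling_instant_0: "sampling_instant Tc 0 = 0"
  by (simp add: sampling_instant_def)

lemma sampling_instant_strict_mono: "Tc > 0 \<Longrightarrow> strict_mono (sampling_instant Tc)"
  by (simp add: strict_mono_Suc_iff sampling_instant_def)

lemma sampling_instant_tendsto: "sampling_instant Tc \<longlonglongrightarrow> Tc"
proof -
  have "sampling_instant Tc n = 6 / pi\<^sup>2 * Tc * (\<Sum>k<n. 1 / (real k + 1)\<^sup>2)" for n
  proof -
    have "sampling_instant Tc n = (\<Sum>k<n. 6 / (pi * real (Suc k))\<^sup>2 * Tc)"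
      unfolding sampling_instant_def by (induction n) auto
    then show ?thesis
      by (simp add: sum_distrib_left power_mult_distrib add.commute mult_ac)
  qed
  moreover have "(\<lambda>n. 6 / pi\<^sup>2 * Tc * (\<Sum>k<n. 1 / (real k + 1)\<^sup>2)) \<longlonglongrightarrow> 6 / pi\<^sup>2 * Tc * (pi\<^sup>2 / 6)"
    using inverse_squares_sums by (intro tendsto_mult_left) (simp add: sums_def add.commute)
  ultimately have "(\<lambda>n. sampling_instant Tc n) \<longlonglongrightarrow> 6 / pi\<^sup>2 * Tc * (pi\<^sup>2 / 6)"
    by (simp only:)
  then show ?thesis by simp
qed

text \<open>The least \<open>n\<close> with \<open>s < t n\<close> is positive because
  \<open>t 0 \<le> s\<close>; its predecessor is the required index.\<close>

lemma consecutive_interval_cover: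
  fixes t :: "nat \<Rightarrow> real"
  assumes t: "t \<longlonglongrightarrow> T" and s: "t 0 \<le> s" "s < T"
  obtains k where "t k \<le> s" "s < t (Suc k)"
proof -
  have "\<exists>n. s < t n" using eventually_happens'[OF _ order_tendstoD(1)[OF t s(2)]] by simp
  then have L: "s < t (LEAST n. s < t n)" by (rule LeastI_ex)
  then obtain k where k: "(LEAST n. s < t n) = Suc k"
    using s(1) by (cases "LEAST n. s < t n") auto
  then have "\<not> s < t k" by (intro not_less_Least) simp
  then show ?thesis using that[of k] L k by simp
qed

text \<open>Beyond \<open>t N\<close> and before \<open>T\<close>, the function takes only values
  \<open>X k\<close> with \<open>k \<ge> N\<close>.\<close>

lemma step_function_tendsto_at_left:
  fixes t :: "nat \<Rightarrow> real"
  assumes mono: "strict_mono t" and t: "t \<longlonglongrightarrow> T" and X: "X \<longlonglongrightarrow> a"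
    and x: "\<And>k s. s \<in> {t k..<t (Suc k)} \<Longrightarrow> x s = X k"
  shows "(x \<longlongrightarrow> a) (at_left T)"
proof (rule topological_tendstoI)
  fix S assume "open S" "a \<in> S"
  with X obtain N where N: "\<And>k. k \<ge> N \<Longrightarrow> X k \<in> S"
    unfolding tendsto_def eventually_sequentially by blast
  have "t N < t (Suc N)" using mono by (simp add: strict_mono_less)
  also have "t (Suc N) \<le> T"
    using mono t by (intro incseq_le) (simp add: strict_mono_mono)
  finally have "eventually (\<lambda>s. s \<in> {t N<..<T}) (at_left T)"
    by (rule eventually_at_left_real)
  then show "eventually (\<lambda>s. x s \<in> S) (at_left T)"
  proof eventually_elim
    case (elim s)
    have "t 0 \<le> t N" using mono by (simp add: strict_mono_less_eq)
    then obtain k where k: "t k \<le> s" "s < t (Suc k)"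
      using consecutive_interval_cover[OF t, of s] elim by auto
    then have "t N < t (Suc k)" using elim by simp
    then have "N \<le> k" using mono by (simp add: strict_mono_less)
    then show ?case using N x[of s k] k by simp
  qed
qed

lemma constant_derivative_increment:
  fixes u :: "real \<Rightarrow> real"
  assumes ab: "a < b" and cont: "continuous_on {a..b} u"
    and u: "\<And>s. s \<in> {a..<b} \<Longrightarrow> (u has_real_derivative c) (at s within {a..<b})"
  shows "u b = u a + c * (b - a)"
proof -
  have d: "(u has_real_derivative c) (at s)" if "a < s" "s < b" for s
  proof -
    \<comment> \<open>At interior points the one-sided formulation yields an ordinary derivative, as
      the mean value theorem requires.\<close>
    have "(u has_real_derivative c) (at s within {a<..<b})"
      using u[of s] that by (auto intro: has_field_derivative_subset)
    then show ?thesis using that by (simp add: at_within_open[of s "{a<..<b}"])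
  qed
  obtain c' z where z: "a < z" "z < b" "(u has_real_derivative c') (at z)" "u b - u a = (b - a) * c'"
    using MVT[OF ab cont] d real_differentiable_def by metis
  then have "c' = c" using d DERIV_unique by blast
  then show ?thesis using z by (simp add: algebra_simps)
qed

text \<open>Integrating the algorithm over one sampling interval, with \<open>\<Xi>\<close> and \<open>\<epsilon>\<close> the vector of the
  sampled \<open>\<xi>\<close> and the tracking error \<open>\<psi> - 1 \<otimes> \<nabla>f\<close>.\<close>

lemma algorithm_sampled_recursion:
  fixes E :: "('n::finite \<times> 'n) set" and x :: "real \<Rightarrow> real^'n"
  assumes alg: "generated_by_algorithm E f \<beta> t x \<xi> \<psi>" and mono: "strict_mono t"
  defines "G \<equiv> \<lambda>z :: real^'n. (\<chi> i. deriv (f i) (z $ i))"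
  defines "\<Xi> \<equiv> \<lambda>k. (\<chi> i. \<xi> i (t k))"
  defines "X \<equiv> \<lambda>k. x 0 - laplacian_out E *v \<Xi> k"
  defines "\<epsilon> \<equiv> \<lambda>k. (\<chi> p. \<psi> (fst p) (snd p) (t k)) - copies (G (X k))"
  shows "s \<in> {t k..<t (Suc k)} \<Longrightarrow> x s = X k"
    and "\<Xi> (Suc k) = \<Xi> k + \<beta> *\<^sub>R (transpose (laplacian_out E) *v G (X k) + lap_hat E *v \<epsilon> k)"
    and "\<epsilon> (Suc k) = M_mat E *v \<epsilon> k + copies (G (X k) - G (X (Suc k)))"
proof -
  have less: "t k < t (Suc k)" for k using mono by (simp add: strict_mono_less)
  have x: "x s = X k" if "s \<in> {t k..<t (Suc k)}" for k s
    using alg that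
    by (simp add: generated_by_algorithm_def vec_eq_iff X_def \<Xi>_def laplacian_out_mult_nth)
  then show "s \<in> {t k..<t (Suc k)} \<Longrightarrow> x s = X k" .
  \<comment> \<open>The right end of each interval belongs to the next one, so continuity on the
    union reaches it.\<close>
  have sub: "{t k..t (Suc k)} \<subseteq> (\<Union>k. {t k..<t (Suc k)})"
  proof
    fix s assume "s \<in> {t k..t (Suc k)}"
    then have "s \<in> {t k..<t (Suc k)} \<or> s \<in> {t (Suc k)..<t (Suc (Suc k))}"
      using less[of "Suc k"] by auto
    then show "s \<in> (\<Union>k. {t k..<t (Suc k)})" by blast
  qed
  \<comment> \<open>The rate is scaled by the interval length, so the increment \<open>c\<close> is
    independent of that length.\<close>
  have mean: "u (t (Suc k)) = u (t k) + c"
    if "continuous_on (\<Union>k. {t k..<t (Suc k)}) u"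
      and "\<And>s. s \<in> {t k..<t (Suc k)} \<Longrightarrow>
        (u has_real_derivative c / (t (Suc k) - t k)) (at s within {t k..<t (Suc k)})" for u c
    using constant_derivative_increment[OF less continuous_on_subset[OF that(1) sub] that(2)]
      less[of k] by simp
  have "\<xi> i (t (Suc k)) = \<xi> i (t k)
      + \<beta> * (out_deg E i * \<psi> i i (t k) - (\<Sum>j\<in>UNIV. adj E $ j $ i * \<psi> i j (t k)))" for i
    using alg by (intro mean) (auto simp: generated_by_algorithm_def)
  then have "\<Xi> (Suc k) = \<Xi> k + \<beta> *\<^sub>R (lap_hat E *v (\<chi> p. \<psi> (fst p) (snd p) (t k)))"
    by (simp add: vec_eq_iff \<Xi>_def lap_hat_mult_nth)
  also have "(\<chi> p. \<psi> (fst p) (snd p) (t k)) = copies (G (X k)) + \<epsilon> k"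
    by (simp add: \<epsilon>_def)
  finally show "\<Xi> (Suc k)
      = \<Xi> k + \<beta> *\<^sub>R (transpose (laplacian_out E) *v G (X k) + lap_hat E *v \<epsilon> k)"
    by (simp only: matrix_vector_right_distrib lap_hat_copies)
  have X: "x (t k) = X k" using x[of "t k" k] less by simp
  have "\<psi> i m (t (Suc k)) = \<psi> i m (t k) + - (1 / (in_deg E i + adj E $ i $ m) *
      ((\<Sum>j\<in>UNIV. adj E $ i $ j * (\<psi> i m (t k) - \<psi> j m (t k)))
       + adj E $ i $ m * (\<psi> i m (t k) - deriv (f m) (x (t k) $ m))))" for i m
    using alg by (intro mean) (auto simp: generated_by_algorithm_def mult.commute)
  \<comment> \<open>The copied gradient cancels in the differences of \<open>\<psi>\<close> and
    turns the reference term into an entry of \<open>\<epsilon> k\<close>; only its increment over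
    the step remains.\<close>
  then show "\<epsilon> (Suc k) = M_mat E *v \<epsilon> k + copies (G (X k) - G (X (Suc k)))"
    by (simp add: vec_eq_iff \<epsilon>_def M_mat_mult_nth X G_def)
qed

theorem theorem1:
  fixes E :: "('n::finite \<times> 'n) set"
    and f :: "'n \<Rightarrow> real \<Rightarrow> real"
    and l0 l Tc \<beta> C :: real
    and W :: "real^('n \<times> 'n)^('n \<times> 'n)"
    and x :: "real \<Rightarrow> real^'n"
    and \<xi> :: "'n \<Rightarrow> real \<Rightarrow> real"
    and \<psi> :: "'n \<Rightarrow> 'n \<Rightarrow> real \<Rightarrow> real"
    and xstar :: "real^'n"
  assumes "CARD('n) \<ge> 2"
    and "strongly_connected E"
    and "objective_assumption f l0 l"
    and "Tc > 0"
    and "C = (\<Sum>i\<in>UNIV. x 0 $ i)"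
    and "is_arg_min (objective f) (\<lambda>y. (\<Sum>i\<in>UNIV. y $ i) = C) xstar"
    and "generated_by_algorithm E f \<beta> (sampling_instant Tc) x \<xi> \<psi>"
    and "lyapunov_solution (M_mat E) W"
    and "0 < \<beta>" and "\<beta> \<le> gain_bound E l W"
  shows "(x \<longlongrightarrow> xstar) (at_left Tc) \<and>
         (\<forall>t\<in>{0..Tc}. (\<Sum>i\<in>UNIV. (x(Tc := Lim (at_left Tc) x)) t $ i) = C)"
proof -
  define t where "t = sampling_instant Tc"
  define G where "G y = (\<chi> i. deriv (f i) (y $ i))" for y :: "real^'n"
  define \<Xi> where "\<Xi> k = (\<chi> i. \<xi> i (t k))" for k
  define X where "X k = x 0 - laplacian_out E *v \<Xi> k" for k
  define \<epsilon> where "\<epsilon> k = (\<chi> p. \<psi> (fst p) (snd p) (t k)) - copies (G (X k))" for k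
  \<comment> \<open>The function \<open>\<xi> \<mapsto> f (x 0 - L\<^sub>O \<xi>)\<close> has
    gradient \<open>- L\<^sub>O\<^sup>T G (X k)\<close> at \<open>\<Xi> k\<close>, so
    \<open>d k\<close> is a descent step disturbed by the estimation error.\<close>
  define d where "d k = \<beta> *\<^sub>R (transpose (laplacian_out E) *v G (X k) + lap_hat E *v \<epsilon> k)" for k
  have mono: "strict_mono t" and lim: "t \<longlonglongrightarrow> Tc" and t0: "t 0 = 0"
    using assms(4) by (simp_all add: t_def sampling_instant_strict_mono sampling_instant_tendsto
        sampling_instant_0)
  have "generated_by_algorithm E f \<beta> t x \<xi> \<psi>" using assms(7) by (simp add: t_def)
  note sampled = algorithm_sampled_recursion[OF this mono]
  have x: "x \<tau> = X k" if "\<tau> \<in> {t k..<t (Suc k)}" for k \<tau>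
    using sampled(1)[OF that] by (simp only: X_def \<Xi>_def)
  have \<Xi>_Suc: "\<Xi> (Suc k) = \<Xi> k + d k" for k
    using sampled(2)[of k] by (simp only: d_def \<epsilon>_def G_def X_def \<Xi>_def)
  have \<epsilon>_Suc: "\<epsilon> (Suc k) = M_mat E *v \<epsilon> k + copies (G (X k) - G (X (Suc k)))" for k
    using sampled(3)[of k] by (simp only: \<epsilon>_def G_def X_def \<Xi>_def)
  have X_Suc: "X (Suc k) = X k - laplacian_out E *v d k" for k
    by (simp only: X_def \<Xi>_Suc matrix_vector_right_distrib diff_diff_eq)
  have sum_X: "(\<Sum>i\<in>UNIV. X k $ i) = C" for k
    by (simp add: X_def sum_subtractf sum_laplacian_out_mult assms(5))
  obtain g where g: "\<And>x. GDERIV (objective f) x :> g x" "l-lipschitz_on UNIV g"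
    and f: "\<And>i s. f i differentiable (at s)"
    using assms(3) unfolding objective_assumption_def by blast
  have "g = G"
    using objective_gradient[OF f g(1)] by (simp add: G_def fun_eq_iff)
  with g have G: "\<And>x. GDERIV (objective f) x :> G x" "l-lipschitz_on UNIV G" by simp_all
  have l0: "l0 > 0" and l: "l > 0" using assms(3) by (simp_all add: objective_assumption_def)

  define b where "b = b_const E W"
  define s where "s = (spectral_norm (laplacian_out E))\<^sup>2"
  have b: "b \<ge> 0" and s: "s \<ge> 0"
    by (simp_all add: b_def b_const_def s_def spectral_norm_nonneg)
  text \<open>A vanishing denominator in \<^const>\<open>gain_bound\<close> is ruled out by \<open>0 < \<beta>\<close>, as \<open>1 / 0 = 0\<close>.\<close>
  have cancel: "\<beta> * c \<le> 1" if "\<beta> \<le> 1 / c" for c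
  proof -
    have "0 < 1 / c" using that assms(9) by linarith
    then show ?thesis using that by (simp add: field_simps)
  qed
  have "\<beta> \<le> 1 / (2 * (spectral_norm (lap_hat E))\<^sup>2 * (1 + 4 * l\<^sup>2 * b * s + 2 * l * s))"
    and "\<beta> \<le> 1 / (4 * (2 * l\<^sup>2 * b * s + l * s))"
    using assms(10) by (simp_all add: gain_bound_def b_def s_def)
  from this[THEN cancel]
  have \<beta>1: "\<beta> * (2 * (spectral_norm (lap_hat E))\<^sup>2 * (1 + 4 * l\<^sup>2 * b * s + 2 * l * s)) \<le> 1"
    and \<beta>2: "4 * \<beta> * (2 * l\<^sup>2 * b * s + l * s) \<le> 1"
    by (simp_all add: mult_ac)
  \<comment> \<open>The bracket in the first gain bound is at least \<open>1\<close>, which gives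
    the form used by the energy estimate.\<close>
  have "2 * \<beta> * (spectral_norm (lap_hat E))\<^sup>2 * 1
      \<le> 2 * \<beta> * (spectral_norm (lap_hat E))\<^sup>2 * (1 + 4 * l\<^sup>2 * b * s + 2 * l * s)"
    using assms(9) b s l by (intro mult_left_mono) auto
  with \<beta>1 have \<beta>1: "2 * \<beta> * (spectral_norm (lap_hat E))\<^sup>2 \<le> 1" by (simp add: mult_ac)

  define V where "V k = objective f (X k) + \<epsilon> k \<bullet> (W *v \<epsilon> k)" for k
  define r where "r k = 3 / (8 * \<beta>) * (norm (d k))\<^sup>2 + (norm (\<epsilon> k))\<^sup>2 / 4" for k
  have "V (Suc k) \<le> V k - r k" for k
    unfolding V_def r_def \<epsilon>_Suc X_Suc
    using inexact_gradient_step_energy_decrease[OF G assms(8,9) \<beta>1 \<beta>2[unfolded s_def]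
        b_def[unfolded b_const_def] _ d_def, of "copies (G (X k) - G (X k - laplacian_out E *v d k))"]
    by (simp add: norm_copies norm_minus_commute)
  moreover have "r k \<ge> 0" for k using assms(9) by (simp add: r_def)
  \<comment> \<open>Every \<open>X k\<close> is feasible and \<open>W\<close> is positive definite,
    so the constrained minimum bounds the energy from below.\<close>
  moreover have "V k \<ge> objective f xstar" for k
  proof -
    have "\<epsilon> k \<bullet> (W *v \<epsilon> k) \<ge> 0"
      using assms(8) by (cases "\<epsilon> k = 0") (auto simp: lyapunov_solution_def sym_pos_def_def less_imp_le)
    moreover have "objective f xstar \<le> objective f (X k)"
      using assms(6) sum_X by (simp add: is_arg_min_linorder)
    ultimately show ?thesis by (simp add: V_def)
  qed
  ultimately have r: "r \<longlonglongrightarrow> 0" by (rule decrement_tendsto_zero)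
  have "(norm (\<epsilon> k))\<^sup>2 \<le> 4 * r k" for k using assms(9) by (simp add: r_def)
  with r have \<epsilon>0: "\<epsilon> \<longlonglongrightarrow> 0" by (rule tendsto_zero_norm_square_le)
  have "(norm (d k))\<^sup>2 \<le> 8 * \<beta> / 3 * r k" for k
    using assms(9) by (simp add: r_def distrib_left)
  with r have d0: "d \<longlonglongrightarrow> 0" by (rule tendsto_zero_norm_square_le)
  \<comment> \<open>Solving the definition of \<open>d k\<close> for the exact direction expresses
    it through two vanishing sequences.\<close>
  have "(\<lambda>k. (1 / \<beta>) *\<^sub>R d k - lap_hat E *v \<epsilon> k) \<longlonglongrightarrow> (1 / \<beta>) *\<^sub>R 0 - lap_hat E *v 0"
    by (intro tendsto_intros d0 bounded_linear.tendsto[OF matrix_vector_mul_bounded_linear] \<epsilon>0)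
  then have LG: "(\<lambda>k. transpose (laplacian_out E) *v G (X k)) \<longlonglongrightarrow> 0"
    using assms(9) by (simp add: d_def del: transpose_matrix_vector)

  obtain K where K: "K > 0" "\<And>v y. (\<Sum>i\<in>UNIV. y $ i) = 0 \<Longrightarrow>
      v \<bullet> y \<le> K * norm (transpose (laplacian_out E) *v v) * norm y"
    using inner_sum_zero_le_transpose_laplacian_out[OF assms(2)] by blast
  have sum_xstar: "(\<Sum>i\<in>UNIV. xstar $ i) = C" using assms(6) by (simp add: is_arg_min_def)
  \<comment> \<open>Error bound: strong monotonicity controls the distance by
    \<open>G (X k) - G xstar\<close> tested with \<open>X k - xstar\<close>. This difference is
    zero-sum, so \<open>G xstar\<close> drops out and the bound with \<open>K\<close> applies to
    \<open>G (X k)\<close>.\<close>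
  have dist: "norm (X k - xstar) \<le> K / l0 * norm (transpose (laplacian_out E) *v G (X k))" for k
  proof -
    define y where "y = X k - xstar"
    have y: "(\<Sum>i\<in>UNIV. y $ i) = 0" by (simp add: y_def sum_subtractf sum_X sum_xstar)
    have "l0 * (norm y)\<^sup>2 \<le> (G (X k) - G xstar) \<bullet> y"
      unfolding y_def G_def by (rule gradient_strongly_monotone[OF assms(3)])
    also have "\<dots> = G (X k) \<bullet> y"
      using constrained_minimizer_gradient[OF G(1) assms(6) y] by (simp add: inner_diff_left)
    also have "\<dots> \<le> K * norm (transpose (laplacian_out E) *v G (X k)) * norm y" by (rule K(2)[OF y])
    finally have "(l0 * norm y) * norm y
        \<le> (K * norm (transpose (laplacian_out E) *v G (X k))) * norm y"
      by (simp only: power2_eq_square mult.assoc)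
    then have "l0 * norm y \<le> K * norm (transpose (laplacian_out E) *v G (X k))"
      using K(1) by (cases "y = 0") (simp_all del: transpose_matrix_vector)
    then show ?thesis using l0 by (simp add: y_def field_simps del: transpose_matrix_vector)
  qed
  have "(\<lambda>k. K / l0 * norm (transpose (laplacian_out E) *v G (X k))) \<longlonglongrightarrow> 0"
    by (intro tendsto_mult_right_zero tendsto_norm_zero LG)
  then have "(\<lambda>k. X k - xstar) \<longlonglongrightarrow> 0"
    by (rule Lim_null_comparison[OF always_eventually, OF allI, OF dist])
  then have "X \<longlonglongrightarrow> xstar" by (rule LIM_zero_cancel)
  then have conv: "(x \<longlongrightarrow> xstar) (at_left Tc)"
    by (rule step_function_tendsto_at_left[OF mono lim _ x])
  \<comment> \<open>The algorithm prescribes \<open>x\<close> only before \<open>Tc\<close>; at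
    \<open>Tc\<close> the updated function takes the left limit \<open>xstar\<close>, which
    satisfies the constraint.\<close>
  moreover have "(\<Sum>i\<in>UNIV. (x(Tc := Lim (at_left Tc) x)) \<tau> $ i) = C" if \<tau>: "\<tau> \<in> {0..Tc}" for \<tau>
  proof (cases "\<tau> = Tc")
    case True
    have "Lim (at_left Tc) x = xstar" using conv by (intro tendsto_Lim) simp
    then show ?thesis using True sum_xstar by simp
  next
    case False
    then obtain k where "t k \<le> \<tau>" "\<tau> < t (Suc k)"
      using consecutive_interval_cover[OF lim, of \<tau>] \<tau> t0 by auto
    then show ?thesis using x[of \<tau> k] sum_X False by simp
  qed
  ultimately show ?thesis by blast
qed

end
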